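(* Let $n\ge 1$, let $r=(r_1,\ldots,r_n)$ with $r_i>0$ for $i=1,\ldots,n$, and let $\ell:\mathbb{R}[\underline{X}]\to\mathbb{R}$ be a linear functional such that the sequence $s(\alpha)=\ell(\underline{X}^\alpha)$, $\alpha\in\mathbb{N}^n$, satisfies $$\sum_{\alpha\in\mathbb{N}^n}|s(\alpha)|\,r_1^{-\alpha_1}\cdots r_n^{-\alpha_n}<\infty.$$ Then $\ell$ is positive semidefinite if and only if there exists a positive Borel measure $\mu$ on $K=\prod_{i=1}^n[-r_i,r_i]$ such that $\ell(f)=\int_K f\,d\mu$ for all $f\in\mathbb{R}[\underline{X}]$.
   Context: Here $\mathbb{R}[\underline{X}]=\mathbb{R}[X_1,\ldots,X_n]$, $\mathbb{N}=\{0,1,2,\ldots\}$, and $\underline{X}^\alpha=X_1^{\alpha_1}\cdots X_n^{\alpha_n}$. A linear functional $\ell:\mathbb{R}[\underline{X}]\to\mathbb{R}$ is positive semidefinite if $\ell(h^2)\ge 0$ for every $h\in\mathbb{R}[\underline{X}]$. Representation of $\ell$ by a measure $\mu$ includes that all polynomials are $\mu$-integrable. *)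

theory Defs
  imports "HOL-Analysis.Analysis" "HOL-Library.Poly_Mapping"
begin

text \<open>
  The polynomial ring in the variables indexed by \<open>'n\<close> is the monoid algebra of the additive
  monoid of finitely supported exponents: the ring structure on \<open>\<Rightarrow>\<^sub>0\<close> is convolution,
  and \<open>Poly_Mapping.single \<alpha> c\<close> is the term \<open>c X\<^sup>\<alpha>\<close>.
\<close>

type_synonym 'n rpoly = "('n \<Rightarrow>\<^sub>0 nat) \<Rightarrow>\<^sub>0 real"

abbreviation monomial :: "('n \<Rightarrow>\<^sub>0 nat) \<Rightarrow> 'n rpoly" where
  "monomial \<alpha> \<equiv> Poly_Mapping.single \<alpha> 1"

definition pscale :: "real \<Rightarrow> 'n rpoly \<Rightarrow> 'n rpoly" where
  "pscale c p = Poly_Mapping.map ((*) c) p"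

definition peval :: "'n::finite rpoly \<Rightarrow> real ^ 'n \<Rightarrow> real" where
  "peval p x =
    (\<Sum>\<alpha>\<in>Poly_Mapping.keys p. Poly_Mapping.lookup p \<alpha> * (\<Prod>i\<in>UNIV. x $ i ^ Poly_Mapping.lookup \<alpha> i))"

definition linear_functional :: "('n rpoly \<Rightarrow> real) \<Rightarrow> bool" where
  "linear_functional l \<longleftrightarrow> Vector_Spaces.linear pscale (*) l"

definition positive_semidefinite :: "('n rpoly \<Rightarrow> real) \<Rightarrow> bool" where
  "positive_semidefinite l \<longleftrightarrow> (\<forall>h. 0 \<le> l (h ^ 2))"

definition sym_box :: "real ^ 'n \<Rightarrow> (real ^ 'n) set" where
  "sym_box r = {x. \<forall>i. - r $ i \<le> x $ i \<and> x $ i \<le> r $ i}"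

text \<open>
  A measure whose \<open>\<sigma>\<close>-algebra is the Borel \<open>\<sigma>\<close>-algebra of the subspace \<open>K\<close>, so that
  \<open>space M = K\<close> and integrals against \<open>M\<close> range over \<open>K\<close>. Integrability is stated separately
  because the Bochner integral of a non-integrable function is \<open>0\<close>.
\<close>

definition borel_measure_on :: "(real ^ 'n) set \<Rightarrow> (real ^ 'n) measure \<Rightarrow> bool" where
  "borel_measure_on K M \<longleftrightarrow> sets M = sets (restrict_space borel K)"

definition represents :: "(real ^ 'n::finite) measure \<Rightarrow> ('n rpoly \<Rightarrow> real) \<Rightarrow> bool" where
  "represents M l \<longleftrightarrow> (\<forall>f. integrable M (peval f) \<and> l f = (LINT x|M. peval f x))"

lemma lookup_pscale: "Poly_Mapping.lookup (pscale c p) \<alpha> = c * Poly_Mapping.lookup p \<alpha>"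
  unfolding pscale_def by (simp add: Poly_Mapping.map.rep_eq when_def)

lemma vector_space_pscale: "vector_space (pscale :: real \<Rightarrow> 'n rpoly \<Rightarrow> 'n rpoly)"
  by unfold_locales
    (auto intro!: poly_mapping_eqI simp: lookup_pscale lookup_add algebra_simps)

lemma linear_functional_iff:
  "linear_functional l \<longleftrightarrow>
    (\<forall>p q. l (p + q) = l p + l q) \<and> (\<forall>c p. l (pscale c p) = c * l p)"
proof -
  have r: "vector_space ((*) :: real \<Rightarrow> real \<Rightarrow> real)"
    by unfold_locales (auto simp: algebra_simps)
  show ?thesis
    unfolding linear_functional_def Vector_Spaces.linear_def module_hom_def module_hom_axioms_def
    using vector_space_pscale r by (auto simp: module_iff_vector_space)
qed

end

theory Submission
  imports Defs "HOL-Probability.Helly_Selection" "HOL-Real_Asymp.Real_Asymp"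
begin

text \<open>
  The nontrivial direction rests on three ideas.
  
  First, positivity. Summability gives a bound \<open>\<bar>l (X\<^sup>\<alpha>)\<bar> \<le> C r\<^sup>\<alpha>\<close>, that is, continuity of \<open>l\<close> for the
  \<open>\<ell>\<^sup>1\<close>-norm of the coefficients with weights \<open>r\<^sup>\<alpha>\<close> (\<open>linear_functional_le_wnorm\<close>). This norm is
  submultiplicative, and \<open>1 - p\<close> is a limit of squares whenever \<open>p\<close> has norm at most 1
  (\<open>limit_of_squares_one_minus\<close>), by the elementary iteration for \<open>1 - \<surd>(1 - p)\<close>. So \<open>r\<^sub>i - X\<^sub>i\<close> and \<open>r\<^sub>i + X\<^sub>i\<close>
  are limits of squares. Products of limits of squares are limits of squares again, hence \<open>l\<close> is
  nonnegative on all products of these linear polynomials, although \<open>l\<close> is only known to be nonnegative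
  on squares.
  
  Second, discrete measures. After rescaling the box to the unit cube, this positivity says that \<open>l\<close> is
  nonnegative on the products of Bernstein basis polynomials. Their values are the masses of a discrete measure
  on a grid in the cube, whose moments approach those of \<open>l\<close> as the grid is refined
  (\<open>hausdorff_moment_cube\<close>).
  
  Third, compactness. A weak limit of the discrete measures is needed. Helly's selection theorem supplies weak limits
  on the real line, and a space-filling curve \<open>g\<close> (\<open>ex_space_filling_curve\<close>) reduces the cube to the
  line: atoms in the cube are lifted along \<open>g\<close>, and the limit measure is pushed forward along \<open>g\<close>
  (\<open>discrete_measures_on_cube_subconverge\<close>).
  
  Conversely, if \<open>l\<close> is integration against a measure, then \<open>l (h\<^sup>2)\<close> is the integral of the square of a
  real function.
\<close>

section \<open>A space-filling curve\<close>

definition unit_cube :: "(real ^ 'n) set" where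
  "unit_cube = {x. \<forall>i. 0 \<le> x $ i \<and> x $ i \<le> 1}"

text \<open>
  The building block of Schoenberg's space-filling curve: a continuous function of period 2 with the
  value 0 on \<open>[0, 1/3]\<close> and 1 on \<open>[2/3, 1]\<close>. Truncating a cosine gives the two plateaus, since
  \<open>cos (\<pi>/3) = 1/2\<close>, and it gives continuity and periodicity without any case distinction.
\<close>

definition trapezoid_wave :: "real \<Rightarrow> real" where
  "trapezoid_wave t = max 0 (min 1 (1/2 - cos (pi * t)))"

lemma trapezoid_wave_bounds: "0 \<le> trapezoid_wave t" "trapezoid_wave t \<le> 1"
  by (auto simp: trapezoid_wave_def)

lemma continuous_trapezoid_wave: "continuous_on A trapezoid_wave"
  unfolding trapezoid_wave_def by (intro continuous_intros)

text \<open>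
  The two plateaus make the wave read off a ternary digit: the term \<open>u\<close> stands for all later digits,
  and they do not influence the value.
\<close>

lemma trapezoid_wave_digit:
  fixes b :: bool and m :: nat
  assumes "0 \<le> u" "u \<le> 1/3"
  shows "trapezoid_wave (2 * real m + 2 * of_bool b / 3 + u) = of_bool b"
proof -
  have "cos (pi * (2 * real m + 2 * of_bool b / 3 + u)) =
      cos ((2 * pi) * of_int (int m) + pi * (2 * of_bool b / 3 + u))"
    by (simp add: algebra_simps)
  also have "\<dots> = cos (pi * (2 * of_bool b / 3 + u))"
    unfolding cos_add cos_int_2pin sin_int_2pin by simp
  finally have eq: "trapezoid_wave (2 * real m + 2 * of_bool b / 3 + u) =
      max 0 (min 1 (1/2 - cos (pi * (2 * of_bool b / 3 + u))))"
    by (simp only: trapezoid_wave_def)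
  show ?thesis
  proof (cases b)
    case True
    have "cos (pi * (2/3 + u)) \<le> cos (2 * pi / 3)"
      using assms mult_left_mono[of u "1/3" pi] by (intro cos_monotone_0_pi_le) (auto simp: field_simps)
    with True show ?thesis
      unfolding eq by (simp add: cos_120)
  next
    case False
    have "cos (pi / 3) \<le> cos (pi * u)"
      using assms mult_left_mono[of u "1/3" pi] by (intro cos_monotone_0_pi_le) (auto simp: field_simps)
    with False show ?thesis
      unfolding eq by (simp add: cos_60)
  qed
qed

lemma ex_binary_expansion:
  fixes y :: real
  assumes "0 \<le> y" "y \<le> 1"
  shows "\<exists>d :: nat \<Rightarrow> bool. (\<lambda>k. of_bool (d k) / 2 ^ Suc k) sums y"
proof -
  \<comment> \<open>Doubling map: \<open>rem k\<close> is \<open>2\<^sup>k\<close> times what the first \<open>k\<close> digits leave of \<open>y\<close>.\<close>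
  define rem where "rem = rec_nat y (\<lambda>_ z. 2 * z - of_bool (z \<ge> 1/2))"
  have rem_0: "rem 0 = y" and rem_Suc: "rem (Suc k) = 2 * rem k - of_bool (rem k \<ge> 1/2)" for k
    by (simp_all add: rem_def)
  have bounds: "0 \<le> rem k \<and> rem k \<le> 1" for k
    using assms by (induction k) (auto simp: rem_0 rem_Suc)
  define d where "d k = (rem k \<ge> 1/2)" for k
  have partial: "(\<Sum>k<K. of_bool (d k) / 2 ^ Suc k) = y - rem K * (1/2) ^ K" for K
    by (induction K) (simp_all add: rem_0 rem_Suc d_def power_one_over field_simps)
  have "(\<lambda>K. rem K * (1/2) ^ K) \<longlonglongrightarrow> 0"
  proof (rule Lim_null_comparison)
    show "\<forall>\<^sub>F K in sequentially. norm (rem K * (1/2) ^ K) \<le> (1/2) ^ K"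
      using bounds by (auto simp: abs_mult mult_left_le_one_le)
    show "(\<lambda>K. (1/2 :: real) ^ K) \<longlonglongrightarrow> 0"
      by (simp add: LIMSEQ_realpow_zero)
  qed
  then have "(\<lambda>K. y - rem K * (1/2) ^ K) \<longlonglongrightarrow> y - 0"
    by (intro tendsto_intros)
  then show ?thesis
    unfolding sums_def partial[symmetric] by auto
qed

text \<open>
  The witness is \<open>t = \<Sum>j. 2 a\<^sub>j / 3\<^sup>j\<^sup>+\<^sup>1\<close>, a point of the Cantor set. Multiplying it by \<open>3\<^sup>m\<close> shifts the
  expansion by \<open>m\<close> places up to an even integer, because all digits are 0 or 2, and the wave has period 2.
  So one number encodes an arbitrary sequence of bits that the dilated waves recover.
\<close>

lemma ex_trapezoid_wave_digits:
  fixes a :: "nat \<Rightarrow> bool"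
  shows "\<exists>t. 0 \<le> t \<and> t \<le> 1 \<and> (\<forall>m. trapezoid_wave (3 ^ m * t) = of_bool (a m))"
proof -
  define R where "R m = suminf (\<lambda>j. 2 / 3 * of_bool (a (m + j)) * (1/3) ^ j :: real)" for m
  have geo: "(\<lambda>j. 2 / 3 * (1/3) ^ j :: real) sums 1"
    using sums_mult[OF geometric_sums[of "1/3 :: real"], of "2/3"] by simp
  have summ: "summable (\<lambda>j. 2 / 3 * of_bool (a (m + j)) * (1/3) ^ j :: real)" for m
    by (rule summable_comparison_test'[OF sums_summable[OF geo], of 0]) auto
  have R0: "0 \<le> R m" for m
    unfolding R_def by (intro suminf_nonneg summ) auto
  have R1: "R m \<le> 1" for m
    unfolding R_def using suminf_le[OF _ summ sums_summable[OF geo]] sums_unique[OF geo]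
    by auto
  have step: "R m = 2 * of_bool (a m) / 3 + R (Suc m) / 3" for m
    using suminf_split_head[OF summ, of m]
      suminf_mult[OF summ[of "Suc m"], of "1/3"]
    by (simp add: R_def mult_ac)
  have scaled: "\<exists>M::nat. 3 ^ m * R 0 = 2 * real M + R m" for m
  proof (induction m)
    case 0
    show ?case by (intro exI[of _ 0]) simp
  next
    case (Suc m)
    then obtain M where "3 ^ m * R 0 = 2 * real M + R m" by blast
    then have "3 ^ Suc m * R 0 = 2 * real (3 * M + of_bool (a m)) + R (Suc m)"
      using step[of m] by simp
    then show ?case by blast
  qed
  show ?thesis
  proof (intro exI[of _ "R 0"] conjI allI R0 R1)
    fix m
    obtain M where "3 ^ m * R 0 = 2 * real M + R m" using scaled by blast
    then have "3 ^ m * R 0 = 2 * real M + 2 * of_bool (a m) / 3 + R (Suc m) / 3"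
      using step[of m] by simp
    then show "trapezoid_wave (3 ^ m * R 0) = of_bool (a m)"
      using trapezoid_wave_digit[of "R (Suc m) / 3" M "a m"] R0[of "Suc m"] R1[of "Suc m"] by simp
  qed
qed

text \<open>
  Schoenberg's curve. Coordinate \<open>i\<close> of \<open>g t\<close> has the waves at the frequencies \<open>3\<^sup>m\<close>, where \<open>m\<close> runs over the
  codes of the pairs \<open>(i, k)\<close>, as its binary digits. The bits of a single \<open>t\<close> can be chosen freely, hence the
  binary expansions of all coordinates of a point of the cube can be prescribed at once.
\<close>

lemma ex_space_filling_curve:
  "\<exists>g :: real \<Rightarrow> real ^ 'n::finite. continuous_on UNIV g \<and> (\<forall>t. g t \<in> unit_cube) \<and>
     (\<forall>y\<in>unit_cube. \<exists>t\<in>{0..1}. g t = y)"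
proof -
  obtain e :: "'n \<Rightarrow> nat" where e: "inj e"
    using finite_imp_inj_to_nat_seg[OF finite_class.finite_UNIV] by blast
  define c where "c i t = suminf (\<lambda>k. trapezoid_wave (3 ^ prod_encode (e i, k) * t) / 2 ^ Suc k)" for i t
  define g :: "real \<Rightarrow> real ^ 'n" where "g t = (\<chi> i. c i t)" for t
  have half: "(\<lambda>k. 1 / 2 ^ Suc k :: real) sums 1"
    using power_half_series by (simp add: power_one_over)
  have le: "\<bar>trapezoid_wave s / 2 ^ Suc k\<bar> \<le> 1 / 2 ^ Suc k" for s k
    using trapezoid_wave_bounds[of s] by (simp add: field_simps)
  have summ: "summable (\<lambda>k. trapezoid_wave (3 ^ prod_encode (e i, k) * t) / 2 ^ Suc k)" for i t
    using le by (intro summable_comparison_test'[OF sums_summable[OF half], of 0]) (simp only: real_norm_def)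
  have cont: "continuous_on UNIV (c i)" for i
  proof (rule uniform_limit_theorem)
    show "uniform_limit UNIV (\<lambda>N t. \<Sum>k<N. trapezoid_wave (3 ^ prod_encode (e i, k) * t) / 2 ^ Suc k)
        (c i) sequentially"
      unfolding c_def by (rule Weierstrass_m_test[OF _ sums_summable[OF half]]) (use le in auto)
    show "\<forall>\<^sub>F N in sequentially. continuous_on UNIV
       (\<lambda>t. \<Sum>k<N. trapezoid_wave (3 ^ prod_encode (e i, k) * t) / 2 ^ Suc k)"
      by (intro always_eventually allI continuous_intros
          continuous_on_compose2[OF continuous_trapezoid_wave[of UNIV]]) auto
  qed auto
  have "0 \<le> c i t" "c i t \<le> 1" for i t
  proof -
    show "0 \<le> c i t"
      unfolding c_def using trapezoid_wave_bounds by (intro suminf_nonneg summ) auto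
    show "c i t \<le> 1"
      unfolding c_def by (rule sums_le[OF le[THEN abs_le_D1] summable_sums[OF summ] half])
  qed
  then have range: "g t \<in> unit_cube" for t
    by (simp add: g_def unit_cube_def)
  have surj: "\<exists>t\<in>{0..1}. g t = y" if "y \<in> unit_cube" for y
  proof -
    have "\<exists>d. (\<lambda>k. of_bool (d k) / 2 ^ Suc k) sums (y $ i)" for i
      using that by (intro ex_binary_expansion) (auto simp: unit_cube_def)
    then obtain d where d: "\<And>i. (\<lambda>k. of_bool (d i k) / 2 ^ Suc k) sums (y $ i)"
      by metis
    obtain t where t: "0 \<le> t" "t \<le> 1"
      "\<And>m. trapezoid_wave (3 ^ m * t) = of_bool (case prod_decode m of (p, k) \<Rightarrow> d (inv e p) k)"
      using ex_trapezoid_wave_digits[of "\<lambda>m. case prod_decode m of (p, k) \<Rightarrow> d (inv e p) k"] by blast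
    have "c i t = y $ i" for i
      unfolding c_def t(3) using sums_unique[OF d[of i]] by (simp add: inv_f_f[OF e])
    then show ?thesis
      using t by (intro bexI[of _ t]) (auto simp: g_def vec_eq_iff)
  qed
  have "continuous_on UNIV g"
    unfolding g_def using cont by (intro continuous_on_vec_lambda) auto
  with range surj show ?thesis by blast
qed

section \<open>Weak limits of discrete measures on the cube\<close>

lemma compact_unit_cube: "compact (unit_cube :: (real ^ 'n::finite) set)"
proof -
  have "unit_cube = cbox (0 :: real ^ 'n) (\<chi> i. 1)"
    by (auto simp: unit_cube_def mem_box_cart)
  then show ?thesis using compact_cbox by metis
qed

text \<open>
  Weak sequential compactness of the probability measures on the cube, for a sequence of discrete ones.
  Helly's selection theorem is about the real line, and the space-filling curve carries it over to the
  cube: the atoms are lifted to points of \<open>[0, 1]\<close>, the lifted measures are tight and have a weakly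
  convergent subsequence, and the limit is pushed forward. This works because \<open>f \<circ> g\<close> is a bounded
  continuous function on the line for every continuous \<open>f\<close>.
\<close>

lemma discrete_measures_on_cube_subconverge:
  fixes A :: "nat \<Rightarrow> 'a set" and m :: "nat \<Rightarrow> 'a \<Rightarrow> real" and y :: "nat \<Rightarrow> 'a \<Rightarrow> real ^ 'n::finite"
  assumes fin: "\<And>N. finite (A N)"
    and nonneg: "\<And>N a. a \<in> A N \<Longrightarrow> 0 \<le> m N a"
    and total: "\<And>N. (\<Sum>a\<in>A N. m N a) = 1"
    and cube: "\<And>N a. a \<in> A N \<Longrightarrow> y N a \<in> unit_cube"
  shows "\<exists>s M. strict_mono s \<and> prob_space M \<and> sets M = sets (restrict_space borel unit_cube) \<and>
    (\<forall>f :: real ^ 'n \<Rightarrow> real. continuous_on UNIV f \<longrightarrow>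
       (\<lambda>j. \<Sum>a\<in>A (s j). m (s j) a * f (y (s j) a)) \<longlonglongrightarrow> (LINT x|M. f x))"
proof -
  obtain g :: "real \<Rightarrow> real ^ 'n" where cont: "continuous_on UNIV g"
    and range: "\<And>t. g t \<in> unit_cube" and surj: "\<And>y. y \<in> unit_cube \<Longrightarrow> \<exists>t\<in>{0..1}. g t = y"
    using ex_space_filling_curve by metis
  have "\<forall>N a. \<exists>t. a \<in> A N \<longrightarrow> t \<in> {0..1} \<and> g t = y N a"
    using surj[OF cube] by blast
  then have "\<exists>\<tau>. \<forall>N a. a \<in> A N \<longrightarrow> \<tau> N a \<in> {0..1} \<and> g (\<tau> N a) = y N a"
    by (simp only: choice_iff)
  then obtain \<tau> where \<tau>: "\<And>N a. a \<in> A N \<Longrightarrow> \<tau> N a \<in> {0..1}" "\<And>N a. a \<in> A N \<Longrightarrow> g (\<tau> N a) = y N a"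
    by blast
  define P where "P N = point_measure (A N) (\<lambda>a. ennreal (m N a))" for N
  define \<mu> where "\<mu> N = distr (P N) borel (\<tau> N)" for N
  have meas: "\<tau> N \<in> P N \<rightarrow>\<^sub>M borel" for N
    by (simp add: P_def)
  have "prob_space (P N)" for N
    unfolding P_def using fin nonneg total[of N] by (intro prob_space_point_measure) auto
  then have "prob_space (\<mu> N)" for N
    unfolding \<mu>_def using meas by (intro prob_space.prob_space_distr)
  then have distribution: "real_distribution (\<mu> N)" for N
    by (simp add: real_distribution_def real_distribution_axioms_def \<mu>_def)
  have lint: "(LINT t|\<mu> N. h t) = (\<Sum>a\<in>A N. m N a * h (\<tau> N a))"
    if "continuous_on UNIV h" for N and h :: "real \<Rightarrow> real"
  proof -
    have "(LINT t|\<mu> N. h t) = (LINT a|P N. h (\<tau> N a))"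
      unfolding \<mu>_def using meas borel_measurable_continuous_onI[OF that] by (intro integral_distr)
    then show ?thesis
      unfolding P_def using fin nonneg by (simp add: lebesgue_integral_point_measure_finite)
  qed
  have "measure (\<mu> N) {-1<..1} = 1" for N
  proof -
    interpret P: prob_space "P N" by fact
    have "measure (\<mu> N) {-1<..1} = measure (P N) (\<tau> N -` {-1<..1} \<inter> space (P N))"
      unfolding \<mu>_def by (rule measure_distr[OF meas]) simp
    also have "\<tau> N -` {-1<..1} \<inter> space (P N) = space (P N)"
      using \<tau>(1)[of _ N] by (fastforce simp: P_def space_point_measure)
    finally show ?thesis by (simp add: P.prob_space)
  qed
  then have "tight \<mu>"
    unfolding tight_def using distribution
    by (intro conjI allI impI exI[of _ "-1"] exI[where x = 1]) auto
  then obtain s \<nu> where s: "strict_mono s" and \<nu>: "real_distribution \<nu>"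
    and conv: "weak_conv_m (\<mu> \<circ> id \<circ> s) \<nu>"
    using tight_imp_convergent_subsubsequence[of \<mu> id] by (auto simp: strict_mono_def)
  interpret \<nu>: real_distribution \<nu> by fact
  define M where "M = distr \<nu> (restrict_space borel unit_cube) g"
  have g_meas: "g \<in> \<nu> \<rightarrow>\<^sub>M restrict_space borel unit_cube"
    using range borel_measurable_continuous_onI[OF cont]
    by (intro measurable_restrict_space2) (auto simp: measurable_def)
  have "(\<lambda>j. \<Sum>a\<in>A (s j). m (s j) a * f (y (s j) a)) \<longlonglongrightarrow> (LINT x|M. f x)"
    if f: "continuous_on UNIV f" for f :: "real ^ 'n \<Rightarrow> real"
  proof -
    have fg: "continuous_on UNIV (\<lambda>t. f (g t))"
      by (rule continuous_on_compose2[OF f cont]) auto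
    have "bounded (f ` unit_cube)"
      using compact_unit_cube f by (meson compact_continuous_image compact_imp_bounded continuous_on_subset subset_UNIV)
    then obtain B where B: "\<And>x. x \<in> unit_cube \<Longrightarrow> norm (f x) \<le> B"
      unfolding bounded_iff by blast
    have "(\<lambda>j. LINT t|(\<mu> \<circ> id \<circ> s) j. f (g t)) \<longlonglongrightarrow> (LINT t|\<nu>. f (g t))"
    proof (rule weak_conv_imp_integral_bdd_continuous_conv[OF _ \<nu> conv])
      show "isCont (\<lambda>t. f (g t)) t" for t
        using fg by (simp add: continuous_on_eq_continuous_at)
      show "norm (f (g t)) \<le> B" for t
        using B range by blast
    qed (simp add: distribution)
    moreover have "(LINT t|(\<mu> \<circ> id \<circ> s) j. f (g t)) = (\<Sum>a\<in>A (s j). m (s j) a * f (y (s j) a))" for j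
      using lint[OF fg, of "s j"] \<tau>(2) by simp
    moreover have "(LINT x|M. f x) = (LINT t|\<nu>. f (g t))"
      unfolding M_def using borel_measurable_continuous_onI[OF f]
      by (intro integral_distr[OF g_meas] measurable_restrict_space1)
    ultimately show ?thesis by simp
  qed
  moreover have "prob_space M"
    unfolding M_def by (rule \<nu>.prob_space_distr[OF g_meas])
  moreover have "sets M = sets (restrict_space borel unit_cube)"
    by (simp add: M_def)
  ultimately show ?thesis
    using s by blast
qed

section \<open>The Hausdorff moment problem on the cube\<close>

text \<open>
  The Bernstein basis polynomials \<open>(N choose a) t\<^sup>a (1 - t)\<^sup>N\<^sup>-\<^sup>a\<close> behave like the weights of a binomial
  distribution, and this is its \<open>k\<close>-th factorial moment. It follows from
  \<open>(N choose a) (a choose k) = (N choose k) (N-k choose a-k)\<close> and the binomial theorem for \<open>t + (1 - t)\<close>.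
  It is an identity in the ring and so it can be applied inside a functional.
\<close>

lemma bernstein_moment:
  fixes t :: "'a::comm_ring_1"
  assumes "k \<le> N"
  shows "(\<Sum>a\<le>N. of_nat (a choose k) * (of_nat (N choose a) * t ^ a * (1 - t) ^ (N - a)))
    = of_nat (N choose k) * t ^ k"
proof -
  have "(\<Sum>a\<le>N. of_nat (a choose k) * (of_nat (N choose a) * t ^ a * (1 - t) ^ (N - a)))
      = (\<Sum>a=k..N. of_nat ((N choose a) * (a choose k)) * t ^ a * (1 - t) ^ (N - a))"
    by (intro sum.mono_neutral_cong_right) (auto simp: mult_ac binomial_eq_0)
  also have "\<dots> = (\<Sum>a=0+k..(N-k)+k. of_nat ((N choose a) * (a choose k)) * t ^ a * (1 - t) ^ (N - a))"
    using assms by simp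
  also have "\<dots> = (\<Sum>b=0..N-k. of_nat ((N choose (b + k)) * ((b + k) choose k)) * t ^ (b + k) * (1 - t) ^ (N - (b + k)))"
    by (rule sum.shift_bounds_cl_nat_ivl)
  also have "\<dots> = (\<Sum>b=0..N-k. of_nat (N choose k) * t ^ k *
      (of_nat ((N - k) choose b) * t ^ b * (1 - t) ^ (N - k - b)))"
  proof (intro sum.cong refl)
    fix b assume b: "b \<in> {0..N - k}"
    then have "(N choose (b + k)) * ((b + k) choose k) = (N choose k) * ((N - k) choose b)"
      using choose_mult[of k "b + k" N] assms by simp
    then show "of_nat ((N choose (b + k)) * ((b + k) choose k)) * t ^ (b + k) * (1 - t) ^ (N - (b + k))
      = of_nat (N choose k) * t ^ k * (of_nat ((N - k) choose b) * t ^ b * (1 - t) ^ (N - k - b))"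
      by (simp add: power_add mult_ac add.commute)
  qed
  also have "\<dots> = of_nat (N choose k) * t ^ k * (t + (1 - t)) ^ (N - k)"
    unfolding binomial_ring sum_distrib_left atMost_atLeast0 ..
  finally show ?thesis by simp
qed

text \<open>
  Factorial moments turn into ordinary ones, uniformly in \<open>a\<close>: both sides are products of \<open>k\<close> factors
  in \<open>[-1, 1]\<close>, and corresponding factors \<open>(a - j) / (N - j)\<close> and \<open>a / N\<close> differ by at most \<open>k / (N - k)\<close>.
  The condition \<open>2 k < N\<close> keeps the factors with \<open>a < j\<close> above \<open>-1\<close>.
\<close>

lemma binomial_ratio_approx:
  assumes "a \<le> N" "2 * k < N"
  shows "\<bar>real (a choose k) / real (N choose k) - (real a / real N) ^ k\<bar> \<le> real k * (real k / (real N - real k))"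
proof -
  have Nj: "real N - real j > 0" if "j < k" for j
    using assms that by simp
  have "real (a choose k) / real (N choose k) = (\<Prod>j<k. (real a - real j) / (real N - real j))"
    by (simp add: binomial_gbinomial gbinomial_prod_rev prod_dividef atLeast0LessThan)
  moreover have "(real a / real N) ^ k = (\<Prod>j<k. real a / real N)"
    by simp
  moreover have "norm ((\<Prod>j<k. (real a - real j) / (real N - real j)) - (\<Prod>j<k. real a / real N))
      \<le> (\<Sum>j<k. norm ((real a - real j) / (real N - real j) - real a / real N))"
    using assms Nj by (intro norm_prod_diff) (auto simp: abs_le_iff divide_le_eq)
  moreover have "norm ((real a - real j) / (real N - real j) - real a / real N) \<le> real k / (real N - real k)"
    if j: "j \<in> {..<k}" for j
  proof -
    have N: "real N > 0" "real N - real k > 0" using assms by auto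
    have "(real a - real j) / (real N - real j) - real a / real N
        = - (real j / (real N - real j)) * ((real N - real a) / real N)"
      using N Nj[of j] j by (simp add: field_simps)
    then have "norm ((real a - real j) / (real N - real j) - real a / real N)
        = real j / (real N - real j) * ((real N - real a) / real N)"
      using N Nj[of j] j assms by (simp add: abs_mult)
    also have "\<dots> \<le> real j / (real N - real j)"
      using N Nj[of j] j assms by (intro mult_left_le) auto
    also have "\<dots> \<le> real k / (real N - real k)"
      using N j by (intro frac_le) auto
    finally show ?thesis .
  qed
  ultimately show ?thesis
    using sum_bounded_above[of "{..<k}" "\<lambda>j. norm ((real a - real j) / (real N - real j) - real a / real N)"
        "real k / (real N - real k)"] by simp
qed

lemma additive_of_nat_mult:
  fixes L :: "'a::comm_ring_1 \<Rightarrow> real"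
  assumes add: "\<And>p q. L (p + q) = L p + L q"
  shows "L (of_nat n * p) = real n * L p"
proof (induction n)
  case 0
  show ?case using add[of 0 0] by simp
next
  case (Suc n)
  then show ?case by (simp add: add distrib_right)
qed

lemma additive_sum:
  fixes L :: "'a::comm_ring_1 \<Rightarrow> real"
  assumes add: "\<And>p q. L (p + q) = L p + L q"
  shows "L (sum f A) = (\<Sum>a\<in>A. L (f a))"
proof -
  have "L 0 = 0" using add[of 0 0] by simp
  then show ?thesis
    by (induction A rule: infinite_finite_induct) (simp_all add: add)
qed

text \<open>
  The Hausdorff moment problem in several dimensions, in the form of Hildebrandt and Schoenberg, for
  elements \<open>t i\<close> of any commutative ring instead of coordinate functions. Products of Bernstein polynomials
  in the \<open>t i\<close> have nonnegative values \<open>w N a\<close> under \<open>L\<close>. Read as masses at the points \<open>a / N\<close>, they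
  form a measure of total mass \<open>L 1\<close> whose moments tend to those of \<open>L\<close> as \<open>N\<close> grows. The required measure
  is a weak limit of these measures.
\<close>

lemma hausdorff_moment_cube:
  fixes t :: "'n::finite \<Rightarrow> 'a::comm_ring_1" and L :: "'a \<Rightarrow> real"
  assumes add: "\<And>p q. L (p + q) = L p + L q"
    and pos: "\<And>a b. 0 \<le> L (\<Prod>i\<in>UNIV. t i ^ a i * (1 - t i) ^ b i)"
  shows "\<exists>M. finite_measure M \<and> sets M = sets (restrict_space borel (unit_cube :: (real ^ 'n) set)) \<and>
    (\<forall>k. L (\<Prod>i\<in>UNIV. t i ^ k i) = (LINT x|M. (\<Prod>i\<in>UNIV. x $ i ^ k i)))"
proof -
  define A :: "nat \<Rightarrow> ('n \<Rightarrow> nat) set" where "A N = Pi\<^sub>E UNIV (\<lambda>_. {..N})" for N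
  define w where "w N a = L (\<Prod>i\<in>UNIV. of_nat (N choose a i) * t i ^ a i * (1 - t i) ^ (N - a i))" for N a
  have fin: "finite (A N)" for N
    unfolding A_def by (rule finite_PiE) auto
  have A_le: "a i \<le> N" if "a \<in> A N" for a N i
    using that by (auto simp: A_def)
  have w_nonneg: "0 \<le> w N a" for N a
  proof -
    have "w N a = L (of_nat (\<Prod>i\<in>UNIV. N choose a i) * (\<Prod>i\<in>UNIV. t i ^ a i * (1 - t i) ^ (N - a i)))"
      by (simp add: w_def prod.distrib mult.assoc)
    then show ?thesis
      using pos by (simp only: additive_of_nat_mult[of L, OF add]) (simp add: prod_nonneg)
  qed
  \<comment> \<open>Up to the factor \<open>\<Prod>i. N choose k i\<close>, the \<open>k\<close>-th moment of \<open>L\<close> is exactly a factorial moment of the weights.\<close>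
  have moment: "L (\<Prod>i\<in>UNIV. t i ^ k i) =
      (\<Sum>a\<in>A N. w N a * (\<Prod>i\<in>UNIV. real (a i choose k i) / real (N choose k i)))"
    if k: "\<And>i. k i \<le> N" for k N
  proof -
    let ?C = "\<Prod>i\<in>UNIV. N choose k i"
    have C: "?C > 0" using k by (simp add: prod_pos)
    have "of_nat ?C * (\<Prod>i\<in>UNIV. t i ^ k i) = (\<Prod>i\<in>UNIV. \<Sum>a\<in>{..N}.
        of_nat (a choose k i) * (of_nat (N choose a) * t i ^ a * (1 - t i) ^ (N - a)))"
      by (simp only: bernstein_moment[OF k] prod.distrib of_nat_prod)
    also have "\<dots> = (\<Sum>a\<in>A N. \<Prod>i\<in>UNIV.
        of_nat (a i choose k i) * (of_nat (N choose a i) * t i ^ a i * (1 - t i) ^ (N - a i)))"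
      unfolding A_def by (rule prod_sum_PiE) auto
    also have "\<dots> = (\<Sum>a\<in>A N. of_nat (\<Prod>i\<in>UNIV. a i choose k i) *
        (\<Prod>i\<in>UNIV. of_nat (N choose a i) * t i ^ a i * (1 - t i) ^ (N - a i)))"
      by (simp only: prod.distrib of_nat_prod)
    finally have "real ?C * L (\<Prod>i\<in>UNIV. t i ^ k i) = (\<Sum>a\<in>A N. real (\<Prod>i\<in>UNIV. a i choose k i) * w N a)"
      by (metis (no_types, lifting) additive_of_nat_mult[of L, OF add] additive_sum[of L, OF add] sum.cong w_def)
    moreover have "real ?C \<noteq> 0"
      using C by linarith
    ultimately have "L (\<Prod>i\<in>UNIV. t i ^ k i) = (\<Sum>a\<in>A N. real (\<Prod>i\<in>UNIV. a i choose k i) * w N a) / real ?C"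
      by (simp only: eq_divide_eq not_False_eq_True if_True mult.commute)
    then show ?thesis
      by (simp add: sum_divide_distrib prod_dividef mult_ac)
  qed
  have total: "(\<Sum>a\<in>A N. w N a) = L 1" for N
    using moment[of "\<lambda>_. 0" N] by simp
  show ?thesis
  \<comment> \<open>The weights are normalized to total mass 1 for the compactness argument, which needs \<open>L 1 \<noteq> 0\<close>.\<close>
  proof (cases "L 1 = 0")
    case True
    have "w N a = 0" if "a \<in> A N" for N a
      using total[of N] True w_nonneg that fin sum_nonneg_eq_0_iff[of "A N" "w N"] by auto
    then have "L (\<Prod>i\<in>UNIV. t i ^ k i) = 0" for k
      using moment[of k "Max (range k)"] by simp
    then show ?thesis
      by (intro exI[of _ "null_measure (restrict_space borel unit_cube)"])
        (auto intro!: finite_measureI)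
  next
    case False
    define c where "c = L 1"
    have c: "c > 0"
      using False total[of 0] sum_nonneg[of "A 0" "w 0"] w_nonneg by (auto simp: c_def order.order_iff_strict)
    define y :: "nat \<Rightarrow> ('n \<Rightarrow> nat) \<Rightarrow> real ^ 'n" where "y N a = (\<chi> i. real (a i) / real N)" for N a
    obtain s M where s: "strict_mono s" and M: "prob_space M" "sets M = sets (restrict_space borel unit_cube)"
      and lim: "\<And>f :: real ^ 'n \<Rightarrow> real. continuous_on UNIV f \<Longrightarrow>
        (\<lambda>j. \<Sum>a\<in>A (s j). w (s j) a / c * f (y (s j) a)) \<longlonglongrightarrow> (LINT x|M. f x)"
    proof -
      have "\<exists>s M. strict_mono s \<and> prob_space M \<and> sets M = sets (restrict_space borel unit_cube) \<and>
        (\<forall>f :: real ^ 'n \<Rightarrow> real. continuous_on UNIV f \<longrightarrow>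
          (\<lambda>j. \<Sum>a\<in>A (s j). w (s j) a / c * f (y (s j) a)) \<longlonglongrightarrow> (LINT x|M. f x))"
      proof (rule discrete_measures_on_cube_subconverge[OF fin])
        show "y N a \<in> unit_cube" if "a \<in> A N" for N a
          using A_le[OF that] by (auto simp: y_def unit_cube_def divide_le_eq_1)
        show "(\<Sum>a\<in>A N. w N a / c) = 1" for N
          using total c by (simp add: sum_divide_distrib[symmetric] c_def)
      qed (use w_nonneg c in auto)
      then show ?thesis using that by blast
    qed
    have "L (\<Prod>i\<in>UNIV. t i ^ k i) = c * (LINT x|M. (\<Prod>i\<in>UNIV. x $ i ^ k i))" for k
    proof -
      let ?f = "\<lambda>x :: real ^ 'n. \<Prod>i\<in>UNIV. x $ i ^ k i"
      define S where "S N = (\<Sum>a\<in>A N. w N a * ?f (y N a))" for N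
      define err where "err N = (\<Sum>i\<in>UNIV. real (k i) * (real (k i) / (real N - real (k i))))" for N :: nat
      have "(\<lambda>j. c * (\<Sum>a\<in>A (s j). w (s j) a / c * ?f (y (s j) a))) \<longlonglongrightarrow> c * (LINT x|M. ?f x)"
        by (intro tendsto_mult tendsto_const lim continuous_intros)
      then have 1: "(S \<circ> s) \<longlonglongrightarrow> c * (LINT x|M. ?f x)"
        using c by (simp add: S_def o_def sum_distrib_left)
      have bound: "norm (S N - L (\<Prod>i\<in>UNIV. t i ^ k i)) \<le> c * err N" if N: "N > 2 * Max (range k)" for N
      proof -
        have kN: "2 * k i < N" for i
        proof -
          have "k i \<le> Max (range k)" by (intro Max_ge) auto
          with N show ?thesis by linarith
        qed
        have pointwise: "\<bar>(\<Prod>i\<in>UNIV. real (a i choose k i) / real (N choose k i)) - ?f (y N a)\<bar> \<le> err N"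
          if a: "a \<in> A N" for a
        proof -
          have "norm ((\<Prod>i\<in>UNIV. real (a i choose k i) / real (N choose k i)) - ?f (y N a))
            \<le> (\<Sum>i\<in>UNIV. norm (real (a i choose k i) / real (N choose k i) - (y N a $ i) ^ k i))"
            using A_le[OF a] kN
            by (intro norm_prod_diff)
              (auto simp: y_def divide_le_eq_1 binomial_right_mono intro!: power_le_one)
          also have "\<dots> \<le> err N"
            unfolding err_def using binomial_ratio_approx[OF A_le[OF a] kN]
            by (intro sum_mono) (simp add: y_def)
          finally show ?thesis by simp
        qed
        have "S N - L (\<Prod>i\<in>UNIV. t i ^ k i) =
            (\<Sum>a\<in>A N. w N a * (?f (y N a) - (\<Prod>i\<in>UNIV. real (a i choose k i) / real (N choose k i))))"
        proof -
          have "k i \<le> N" for i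
            using kN[of i] by simp
          from moment[OF this] show ?thesis
            by (simp add: S_def right_diff_distrib sum_subtractf)
        qed
        also have "norm \<dots> \<le> (\<Sum>a\<in>A N. w N a * err N)"
          using pointwise w_nonneg by (intro sum_norm_le) (auto simp: abs_mult abs_minus_commute intro!: mult_left_mono)
        also have "\<dots> = c * err N"
          by (simp add: sum_distrib_right[symmetric] total c_def)
        finally show ?thesis .
      qed
      have "err \<longlonglongrightarrow> 0"
      proof -
        have "(\<lambda>N. \<kappa> * (\<kappa> / (real N - \<kappa>))) \<longlonglongrightarrow> 0" for \<kappa> :: real
          by real_asymp
        then have "err \<longlonglongrightarrow> (\<Sum>i\<in>(UNIV :: 'n set). 0)"
          unfolding err_def by (intro tendsto_sum)
        then show ?thesis by simp
      qed
      then have "(\<lambda>N. c * err N) \<longlonglongrightarrow> 0"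
        by (rule tendsto_mult_right_zero)
      then have "(\<lambda>N. S N - L (\<Prod>i\<in>UNIV. t i ^ k i)) \<longlonglongrightarrow> 0"
        by (rule Lim_null_comparison[rotated])
          (use bound in \<open>auto simp: eventually_at_top_dense intro!: exI[of _ "2 * Max (range k)"]\<close>)
      then have "(S \<circ> s) \<longlonglongrightarrow> L (\<Prod>i\<in>UNIV. t i ^ k i)"
        using LIMSEQ_subseq_LIMSEQ[OF _ s] by (simp add: LIM_zero_iff)
      from LIMSEQ_unique[OF this 1] show ?thesis .
    qed
    moreover have "finite_measure (density M (\<lambda>_. ennreal c))"
      using prob_space.emeasure_space_1[OF M(1)]
      by (intro finite_measureI) (simp add: emeasure_density_const)
    moreover have "(LINT x|density M (\<lambda>_. ennreal c). (\<Prod>i\<in>UNIV. x $ i ^ k i)) = c * (LINT x|M. (\<Prod>i\<in>UNIV. x $ i ^ k i))" for k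
    proof -
      have "(\<lambda>x :: real ^ 'n. \<Prod>i\<in>UNIV. x $ i ^ k i) \<in> borel_measurable borel"
        by (intro borel_measurable_continuous_onI continuous_intros)
      then have "(\<lambda>x :: real ^ 'n. \<Prod>i\<in>UNIV. x $ i ^ k i) \<in> borel_measurable M"
        unfolding measurable_cong_sets[OF M(2) refl] by (rule measurable_restrict_space1)
      then show ?thesis
        using c by (subst integral_real_density) auto
    qed
    ultimately show ?thesis
      using M(2) by (intro exI[of _ "density M (\<lambda>_. ennreal c)"]) auto
  qed
qed

section \<open>The weighted coefficient norm and limits of squares\<close>

definition monomial_value :: "real ^ 'n \<Rightarrow> ('n::finite \<Rightarrow>\<^sub>0 nat) \<Rightarrow> real" where
  "monomial_value r \<alpha> = (\<Prod>i\<in>UNIV. r $ i ^ Poly_Mapping.lookup \<alpha> i)"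

text \<open>
  The \<open>\<ell>\<^sup>1\<close>-norm of the coefficients with weights \<open>r\<^sup>\<alpha>\<close>. It is submultiplicative and the functionals that are
  continuous for it are exactly those with \<open>\<bar>l (X\<^sup>\<alpha>)\<bar> \<le> C r\<^sup>\<alpha>\<close>; the normalized variables \<open>X\<^sub>i / r\<^sub>i\<close> have norm 1.
\<close>

definition wnorm :: "real ^ 'n \<Rightarrow> 'n::finite rpoly \<Rightarrow> real" where
  "wnorm r p = (\<Sum>\<alpha>\<in>Poly_Mapping.keys p. \<bar>Poly_Mapping.lookup p \<alpha>\<bar> * monomial_value r \<alpha>)"

lemma monomial_value_add: "monomial_value r (\<alpha> + \<beta>) = monomial_value r \<alpha> * monomial_value r \<beta>"
  by (simp add: monomial_value_def lookup_add power_add prod.distrib)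

lemma monomial_value_pos: "(\<And>i. 0 < r $ i) \<Longrightarrow> 0 < monomial_value r \<alpha>"
  by (simp add: monomial_value_def prod_pos)

lemma sum_keys_superset:
  assumes "finite A" "Poly_Mapping.keys p \<subseteq> A" "\<And>\<alpha>. f \<alpha> 0 = 0"
  shows "(\<Sum>\<alpha>\<in>Poly_Mapping.keys p. f \<alpha> (Poly_Mapping.lookup p \<alpha>)) = (\<Sum>\<alpha>\<in>A. f \<alpha> (Poly_Mapping.lookup p \<alpha>))"
  using assms by (intro sum.mono_neutral_left) (auto simp: in_keys_iff)

lemma rpoly_eq_sum_terms:
  fixes p :: "'n rpoly"
  shows "p = (\<Sum>\<alpha>\<in>Poly_Mapping.keys p. Poly_Mapping.single \<alpha> (Poly_Mapping.lookup p \<alpha>))"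
  by (rule poly_mapping_eqI)
    (auto simp: lookup_sum lookup_single when_def in_keys_iff sum.delta' if_distrib cong: if_cong)

lemma wnorm_add:
  assumes "\<And>i. 0 < r $ i"
  shows "wnorm r (p + q) \<le> wnorm r p + wnorm r q"
proof -
  let ?A = "Poly_Mapping.keys p \<union> Poly_Mapping.keys q \<union> Poly_Mapping.keys (p + q)"
  have eq: "wnorm r f = (\<Sum>\<alpha>\<in>?A. \<bar>Poly_Mapping.lookup f \<alpha>\<bar> * monomial_value r \<alpha>)"
    if "Poly_Mapping.keys f \<subseteq> ?A" for f
    unfolding wnorm_def
    by (rule sum_keys_superset[where f = "\<lambda>\<alpha> c. \<bar>c\<bar> * monomial_value r \<alpha>"]) (use that in auto)
  show ?thesis
    using less_imp_le[OF monomial_value_pos[of r, OF assms]]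
    by (subst (1 2 3) eq)
      (auto simp: sum.distrib[symmetric] lookup_add distrib_right[symmetric] abs_triangle_ineq
        intro!: sum_mono mult_right_mono)
qed

lemma wnorm_0 [simp]: "wnorm r 0 = 0"
  by (simp add: wnorm_def)

lemma wnorm_sum:
  assumes "\<And>i. 0 < r $ i"
  shows "wnorm r (sum f A) \<le> (\<Sum>a\<in>A. wnorm r (f a))"
proof (induction A rule: infinite_finite_induct)
  case (insert a A)
  then show ?case using wnorm_add[of r "f a" "sum f A", OF assms] by simp
qed simp_all

lemma wnorm_single [simp]: "wnorm r (Poly_Mapping.single \<alpha> c) = \<bar>c\<bar> * monomial_value r \<alpha>"
  by (simp add: wnorm_def)

lemma wnorm_minus [simp]: "wnorm r (- p) = wnorm r p"
  by (simp add: wnorm_def)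

lemma wnorm_mult:
  assumes "\<And>i. 0 < r $ i"
  shows "wnorm r (p * q) \<le> wnorm r p * wnorm r q"
proof -
  let ?P = "\<lambda>\<alpha>. Poly_Mapping.single \<alpha> (Poly_Mapping.lookup p \<alpha>)"
  let ?Q = "\<lambda>\<beta>. Poly_Mapping.single \<beta> (Poly_Mapping.lookup q \<beta>)"
  have "p * q = (\<Sum>\<alpha>\<in>Poly_Mapping.keys p. \<Sum>\<beta>\<in>Poly_Mapping.keys q. ?P \<alpha> * ?Q \<beta>)"
    by (subst rpoly_eq_sum_terms[of p], subst rpoly_eq_sum_terms[of q]) (rule sum_product)
  then have "wnorm r (p * q) \<le> (\<Sum>\<alpha>\<in>Poly_Mapping.keys p. \<Sum>\<beta>\<in>Poly_Mapping.keys q. wnorm r (?P \<alpha> * ?Q \<beta>))"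
    by (simp only:) (intro order.trans[OF wnorm_sum[of r, OF assms]] sum_mono wnorm_sum[of r, OF assms])
  also have "\<dots> = wnorm r p * wnorm r q"
    by (simp add: wnorm_def[of r p] wnorm_def[of r q] sum_product mult_single monomial_value_add abs_mult mult_ac)
  finally show ?thesis .
qed

lemma wnorm_nonneg:
  assumes "\<And>i. 0 < r $ i"
  shows "0 \<le> wnorm r p"
  unfolding wnorm_def using less_imp_le[OF monomial_value_pos[of r, OF assms]]
  by (intro sum_nonneg) auto

text \<open>
  Limits of squares for the weighted norm, the elements on which a continuous positive semidefinite
  functional is automatically nonnegative. They are closed under products, because a product of squares is a
  square and the norm is submultiplicative.
\<close>

definition limit_of_squares :: "real ^ 'n \<Rightarrow> 'n::finite rpoly \<Rightarrow> bool" where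
  "limit_of_squares r p \<longleftrightarrow> (\<exists>q :: nat \<Rightarrow> 'n rpoly. (\<lambda>k. wnorm r (q k ^ 2 - p)) \<longlonglongrightarrow> 0)"

lemma limit_of_squares_1: "limit_of_squares r 1"
  unfolding limit_of_squares_def by (intro exI[of _ "\<lambda>_. 1"]) simp

lemma limit_of_squares_mult:
  assumes r: "\<And>i. 0 < r $ i" and "limit_of_squares r p" "limit_of_squares r p'"
  shows "limit_of_squares r (p * p')"
proof -
  obtain q q' where q: "(\<lambda>k. wnorm r (q k ^ 2 - p)) \<longlonglongrightarrow> 0"
    and q': "(\<lambda>k. wnorm r (q' k ^ 2 - p')) \<longlonglongrightarrow> 0"
    using assms(2,3) unfolding limit_of_squares_def by blast
  have "wnorm r ((q k * q' k) ^ 2 - p * p') \<le> wnorm r (q k ^ 2 - p) * wnorm r (q' k ^ 2 - p')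
      + wnorm r (q k ^ 2 - p) * wnorm r p' + wnorm r p * wnorm r (q' k ^ 2 - p')" for k
  proof -
    define a b where "a = q k ^ 2 - p" and "b = q' k ^ 2 - p'"
    have "(q k * q' k) ^ 2 - p * p' = (a * b + a * p') + p * b"
      by (simp add: a_def b_def algebra_simps power_mult_distrib)
    then have "wnorm r ((q k * q' k) ^ 2 - p * p') \<le> wnorm r (a * b + a * p') + wnorm r (p * b)"
      using wnorm_add[of r, OF r] by presburger
    also have "\<dots> \<le> (wnorm r (a * b) + wnorm r (a * p')) + wnorm r (p * b)"
      by (intro add_right_mono wnorm_add r)
    also have "\<dots> \<le> (wnorm r a * wnorm r b + wnorm r a * wnorm r p') + wnorm r p * wnorm r b"
      by (intro add_mono wnorm_mult r)
    finally show ?thesis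
      by (simp only: a_def b_def)
  qed
  then have "norm (wnorm r ((q k * q' k) ^ 2 - p * p')) \<le> wnorm r (q k ^ 2 - p) * wnorm r (q' k ^ 2 - p')
      + wnorm r (q k ^ 2 - p) * wnorm r p' + wnorm r p * wnorm r (q' k ^ 2 - p')" for k
    by (simp add: wnorm_nonneg[of r, OF r])
  moreover have "(\<lambda>k. wnorm r (q k ^ 2 - p) * wnorm r (q' k ^ 2 - p')
      + wnorm r (q k ^ 2 - p) * wnorm r p' + wnorm r p * wnorm r (q' k ^ 2 - p')) \<longlonglongrightarrow> 0"
    by (rule tendsto_eq_intros q q' refl | simp)+
  ultimately have "(\<lambda>k. wnorm r ((q k * q' k) ^ 2 - p * p')) \<longlonglongrightarrow> 0"
    by (rule Lim_null_comparison[OF always_eventually[OF allI]])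
  then show ?thesis
    unfolding limit_of_squares_def by (intro exI[of _ "\<lambda>k. q k * q' k"])
qed

lemma limit_of_squares_power:
  assumes "\<And>i. 0 < r $ i" "limit_of_squares r p"
  shows "limit_of_squares r (p ^ k)"
  by (induction k) (simp_all add: limit_of_squares_1 limit_of_squares_mult assms)

lemma limit_of_squares_prod:
  assumes "\<And>i. 0 < r $ i" "\<And>a. a \<in> A \<Longrightarrow> limit_of_squares r (f a)"
  shows "limit_of_squares r (\<Prod>a\<in>A. f a)"
  using assms(2) by (induction A rule: infinite_finite_induct)
    (simp_all add: limit_of_squares_1 limit_of_squares_mult assms(1))

text \<open>
  The point where the norm enters: \<open>1 - p\<close> has a square root in the completion when \<open>p\<close> has norm at most 1,
  the boundary case included. The square root is the limit of \<open>1 - u k\<close>, where \<open>u (k+1) = (p + (u k)\<^sup>2) / 2\<close>, and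
  the squares satisfy \<open>(1 - u k)\<^sup>2 - (1 - p) = 2 (u (k+1) - u k)\<close>. The increments of \<open>u\<close> are dominated by those
  of the real sequence \<open>w\<close> of the same recursion at \<open>p = 1\<close>, which increases and stays below 1, so they
  tend to 0.
\<close>

lemma limit_of_squares_one_minus:
  fixes p :: "'n::finite rpoly"
  assumes r: "\<And>i. 0 < r $ i" and p: "wnorm r p \<le> 1"
  shows "limit_of_squares r (1 - p)"
proof -
  \<comment> \<open>The constant polynomial one half.\<close>
  define h :: "'n rpoly" where "h = Poly_Mapping.single 0 (1/2)"
  have h2: "h + h = 1"
    by (simp add: h_def single_add[symmetric])
  have h: "wnorm r h = 1/2"
    by (simp add: h_def monomial_value_def)
  define u where "u = rec_nat 0 (\<lambda>_ u. h * (p + u ^ 2))"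
  have u_0: "u 0 = 0" and u_Suc: "u (Suc k) = h * (p + u k ^ 2)" for k
    by (simp_all add: u_def)
  define w :: "nat \<Rightarrow> real" where "w = rec_nat 0 (\<lambda>_ w. (1 + w ^ 2) / 2)"
  have w_0: "w 0 = 0" and w_Suc: "w (Suc k) = (1 + w k ^ 2) / 2" for k
    by (simp_all add: w_def)
  have w_bounds: "0 \<le> w k \<and> w k \<le> 1" for k
    by (induction k) (auto simp: w_0 w_Suc power_le_one)
  have w_mono: "w k \<le> w (Suc k)" for k
    using zero_le_power2[of "1 - w k"] by (simp add: w_Suc power2_diff)
  from w_mono have "incseq w" by (rule incseq_SucI)
  then obtain l where "w \<longlonglongrightarrow> l"
    using incseq_convergent[of w 1] w_bounds by blast
  then have "(\<lambda>k. 2 * (w (Suc k) - w k)) \<longlonglongrightarrow> 2 * (l - l)"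
    by (intro tendsto_intros LIMSEQ_Suc)
  then have lim: "(\<lambda>k. 2 * (w (Suc k) - w k)) \<longlonglongrightarrow> 0" by simp
  have u_le: "wnorm r (u k) \<le> w k" for k
  proof (induction k)
    case 0
    show ?case by (simp add: u_0 w_0)
  next
    case (Suc k)
    have "wnorm r (u (Suc k)) \<le> wnorm r h * (wnorm r p + wnorm r (u k) * wnorm r (u k))"
      unfolding u_Suc power2_eq_square
      by (intro order.trans[OF wnorm_mult[of r h, OF r]] mult_left_mono wnorm_nonneg[of r, OF r]
          order.trans[OF wnorm_add[of r p, OF r]] add_left_mono wnorm_mult[of r "u k", OF r])
    also have "\<dots> \<le> 1/2 * (1 + w k * w k)"
      unfolding h using p Suc wnorm_nonneg[of r, OF r] w_bounds
      by (intro mult_left_mono add_mono mult_mono) auto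
    finally show ?case by (simp add: w_Suc power2_eq_square)
  qed
  have diff_le: "wnorm r (u (Suc k) - u k) \<le> w (Suc k) - w k" for k
  proof (induction k)
    case 0
    have "wnorm r (h * p) \<le> 1/2 * 1"
      using p wnorm_mult[of r h p, OF r] h by simp
    then show ?case by (simp add: u_0 w_0 u_Suc w_Suc)
  next
    case (Suc k)
    have "u (Suc (Suc k)) - u (Suc k) = h * (p + u (Suc k) ^ 2) - h * (p + u k ^ 2)"
      by (rule arg_cong2[where f = minus, OF u_Suc u_Suc])
    also have "\<dots> = h * ((u (Suc k) - u k) * (u (Suc k) + u k))"
      by (simp add: algebra_simps power2_eq_square)
    finally have "wnorm r (u (Suc (Suc k)) - u (Suc k)) \<le>
        wnorm r h * (wnorm r (u (Suc k) - u k) * (wnorm r (u (Suc k)) + wnorm r (u k)))"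
      by (simp only:) (intro order.trans[OF wnorm_mult[of r h, OF r]] mult_left_mono wnorm_nonneg[of r, OF r]
          order.trans[OF wnorm_mult[of r "u (Suc k) - u k", OF r]] wnorm_add[of r, OF r])
    also have "\<dots> \<le> 1/2 * ((w (Suc k) - w k) * (w (Suc k) + w k))"
      unfolding h using Suc u_le[of k] u_le[of "Suc k"] wnorm_nonneg[of r, OF r] w_bounds w_mono[of k]
      by (intro mult_left_mono mult_mono add_mono) auto
    also have "\<dots> = (1 + w (Suc k) ^ 2) / 2 - (1 + w k ^ 2) / 2"
      by (simp add: field_simps power2_eq_square)
    also have "\<dots> = w (Suc (Suc k)) - w (Suc k)"
      by (rule arg_cong2[where f = minus, OF w_Suc[symmetric] w_Suc[symmetric]])
    finally show ?case .
  qed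
  have "wnorm r ((1 - u k) ^ 2 - (1 - p)) \<le> 2 * (w (Suc k) - w k)" for k
  proof -
    have "u (Suc k) + u (Suc k) = (h + h) * (p + u k ^ 2)"
      by (simp add: u_Suc distrib_right)
    then have "(1 - u k) ^ 2 - (1 - p) = (u (Suc k) - u k) + (u (Suc k) - u k)"
      unfolding h2 by (simp add: power2_eq_square algebra_simps)
    then show ?thesis
      using wnorm_add[of r "u (Suc k) - u k" "u (Suc k) - u k", OF r] diff_le[of k] by simp
  qed
  then have "(\<lambda>k. wnorm r ((1 - u k) ^ 2 - (1 - p))) \<longlonglongrightarrow> 0"
    by (intro Lim_null_comparison[OF always_eventually[OF allI] lim]) (simp add: wnorm_nonneg[of r, OF r])
  then show ?thesis
    unfolding limit_of_squares_def by (intro exI[of _ "\<lambda>k. 1 - u k"])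
qed

lemma nonneg_on_limit_of_squares:
  assumes l: "linear_functional l" and psd: "positive_semidefinite l"
    and C: "\<And>p. \<bar>l p\<bar> \<le> C * wnorm r p" and p: "limit_of_squares r p"
  shows "0 \<le> l p"
proof -
  obtain q where q: "(\<lambda>k. wnorm r (q k ^ 2 - p)) \<longlonglongrightarrow> 0"
    using p unfolding limit_of_squares_def by blast
  have "(\<lambda>k. C * wnorm r (q k ^ 2 - p)) \<longlonglongrightarrow> 0"
    using tendsto_mult_right_zero[OF q] .
  then have "(\<lambda>k. l (q k ^ 2 - p)) \<longlonglongrightarrow> 0"
    by (rule Lim_null_comparison[rotated]) (simp add: C)
  moreover have "l (q k ^ 2 - p) + l p = l (q k ^ 2)" for k
    using l unfolding linear_functional_iff by (metis diff_add_cancel)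
  then have "l (q k ^ 2 - p) = l (q k ^ 2) - l p" for k
    by (simp add: eq_diff_eq)
  ultimately have "(\<lambda>k. l (q k ^ 2)) \<longlonglongrightarrow> l p"
    by (simp add: LIM_zero_iff)
  then show ?thesis
    by (rule LIMSEQ_le_const) (use psd in \<open>auto simp: positive_semidefinite_def\<close>)
qed

lemma linear_functional_sum_terms:
  assumes "linear_functional l"
  shows "l p = (\<Sum>\<alpha>\<in>Poly_Mapping.keys p. Poly_Mapping.lookup p \<alpha> * l (monomial \<alpha>))"
proof -
  have add: "\<And>p q. l (p + q) = l p + l q" and scale: "\<And>c p. l (pscale c p) = c * l p"
    using assms unfolding linear_functional_iff by auto
  have single: "l (Poly_Mapping.single \<alpha> c) = c * l (monomial \<alpha>)" for \<alpha> c
    using scale[of c "monomial \<alpha>"] by (simp add: pscale_def map_single)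
  have "l p = (\<Sum>\<alpha>\<in>Poly_Mapping.keys p. l (Poly_Mapping.single \<alpha> (Poly_Mapping.lookup p \<alpha>)))"
    by (subst rpoly_eq_sum_terms[of p]) (rule additive_sum[OF add])
  also have "\<dots> = (\<Sum>\<alpha>\<in>Poly_Mapping.keys p. Poly_Mapping.lookup p \<alpha> * l (monomial \<alpha>))"
    by (rule sum.cong[OF refl single])
  finally show ?thesis .
qed

lemma linear_functional_le_wnorm:
  assumes l: "linear_functional l" and C: "\<And>\<alpha>. \<bar>l (monomial \<alpha>)\<bar> \<le> C * monomial_value r \<alpha>"
  shows "\<bar>l p\<bar> \<le> C * wnorm r p"
proof -
  have "\<bar>l p\<bar> \<le> (\<Sum>\<alpha>\<in>Poly_Mapping.keys p. \<bar>Poly_Mapping.lookup p \<alpha> * l (monomial \<alpha>)\<bar>)"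
    unfolding linear_functional_sum_terms[OF l, of p] by (rule sum_abs)
  also have "\<dots> \<le> (\<Sum>\<alpha>\<in>Poly_Mapping.keys p. \<bar>Poly_Mapping.lookup p \<alpha>\<bar> * (C * monomial_value r \<alpha>))"
    using C by (intro sum_mono) (auto simp: abs_mult intro: mult_left_mono)
  also have "\<dots> = C * wnorm r p"
    by (simp add: wnorm_def sum_distrib_left mult_ac)
  finally show ?thesis .
qed

section \<open>Evaluation of polynomials\<close>

lemma peval_superset:
  assumes "finite A" "Poly_Mapping.keys p \<subseteq> A"
  shows "peval p x = (\<Sum>\<alpha>\<in>A. Poly_Mapping.lookup p \<alpha> * monomial_value x \<alpha>)"
  unfolding peval_def monomial_value_def
  by (rule sum_keys_superset[where f = "\<lambda>\<alpha> c. c * (\<Prod>i\<in>UNIV. x $ i ^ Poly_Mapping.lookup \<alpha> i)"])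
    (use assms in auto)

lemma peval_add: "peval (p + q) x = peval p x + peval q x"
proof -
  let ?A = "Poly_Mapping.keys p \<union> Poly_Mapping.keys q \<union> Poly_Mapping.keys (p + q)"
  have "peval f x = (\<Sum>\<alpha>\<in>?A. Poly_Mapping.lookup f \<alpha> * monomial_value x \<alpha>)"
    if "Poly_Mapping.keys f \<subseteq> ?A" for f
    using that by (intro peval_superset) auto
  then have "peval p x = (\<Sum>\<alpha>\<in>?A. Poly_Mapping.lookup p \<alpha> * monomial_value x \<alpha>)"
    "peval q x = (\<Sum>\<alpha>\<in>?A. Poly_Mapping.lookup q \<alpha> * monomial_value x \<alpha>)"
    "peval (p + q) x = (\<Sum>\<alpha>\<in>?A. Poly_Mapping.lookup (p + q) \<alpha> * monomial_value x \<alpha>)"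
    by blast+
  then show ?thesis
    by (simp only: lookup_add distrib_right sum.distrib)
qed

lemma peval_single [simp]: "peval (Poly_Mapping.single \<alpha> c) x = c * monomial_value x \<alpha>"
  by (simp add: peval_def monomial_value_def)

lemma peval_0 [simp]: "peval 0 x = 0"
  by (simp add: peval_def)

lemma peval_1 [simp]: "peval 1 x = 1"
  by (simp add: single_one[symmetric] monomial_value_def del: single_one)

lemma peval_sum: "peval (sum f A) x = (\<Sum>a\<in>A. peval (f a) x)"
  by (induction A rule: infinite_finite_induct) (simp_all add: peval_add)

lemma peval_mult: "peval (p * q) x = peval p x * peval q x"
proof -
  let ?P = "\<lambda>\<alpha>. Poly_Mapping.single \<alpha> (Poly_Mapping.lookup p \<alpha>)"
  let ?Q = "\<lambda>\<beta>. Poly_Mapping.single \<beta> (Poly_Mapping.lookup q \<beta>)"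
  have "p * q = (\<Sum>\<alpha>\<in>Poly_Mapping.keys p. \<Sum>\<beta>\<in>Poly_Mapping.keys q. ?P \<alpha> * ?Q \<beta>)"
    by (subst rpoly_eq_sum_terms[of p], subst rpoly_eq_sum_terms[of q]) (rule sum_product)
  then have "peval (p * q) x = (\<Sum>\<alpha>\<in>Poly_Mapping.keys p. \<Sum>\<beta>\<in>Poly_Mapping.keys q. peval (?P \<alpha> * ?Q \<beta>) x)"
    by (simp only: peval_sum)
  also have "\<dots> = peval p x * peval q x"
    by (simp add: peval_def[of p] peval_def[of q] monomial_value_def[symmetric] sum_product mult_single monomial_value_add mult_ac)
  finally show ?thesis .
qed

lemma peval_power: "peval (p ^ k) x = peval p x ^ k"
  by (induction k) (simp_all add: peval_mult)

lemma peval_prod: "peval (\<Prod>a\<in>A. f a) x = (\<Prod>a\<in>A. peval (f a) x)"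
  by (induction A rule: infinite_finite_induct) (simp_all add: peval_mult)

lemma continuous_on_peval: "continuous_on A (peval p)"
  unfolding peval_def by (intro continuous_intros)

section \<open>Representing measures on the box\<close>

definition var :: "'n \<Rightarrow> 'n rpoly" where
  "var i = monomial (Poly_Mapping.single i 1)"

lemma monomial_value_unit: "monomial_value x (Poly_Mapping.single i 1) = x $ i"
proof -
  have "monomial_value x (Poly_Mapping.single i 1) = (\<Prod>j\<in>UNIV. if i = j then x $ j else 1)"
    unfolding monomial_value_def by (intro prod.cong) (auto simp: lookup_single when_def)
  then show ?thesis by simp
qed

lemma monomial_induct [case_names zero add]:
  fixes P :: "('n::finite \<Rightarrow>\<^sub>0 nat) \<Rightarrow> bool"
  assumes zero: "P 0" and add: "\<And>\<alpha> i. P \<alpha> \<Longrightarrow> P (Poly_Mapping.single i 1 + \<alpha>)"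
  shows "P \<alpha>"
proof (induction "\<Sum>i\<in>UNIV. Poly_Mapping.lookup \<alpha> i" arbitrary: \<alpha>)
  case 0
  then have "\<alpha> = 0" by (auto intro!: poly_mapping_eqI)
  then show ?case using zero by simp
next
  case (Suc d)
  then obtain i where i: "Poly_Mapping.lookup \<alpha> i > 0"
    by (metis gr0I nat.distinct(1) sum.neutral)
  define \<beta> where "\<beta> = \<alpha> - Poly_Mapping.single i 1"
  have \<alpha>: "\<alpha> = Poly_Mapping.single i 1 + \<beta>"
    using i by (intro poly_mapping_eqI) (auto simp: \<beta>_def lookup_add lookup_minus lookup_single when_def)
  have "(\<Sum>j\<in>UNIV. Poly_Mapping.lookup \<alpha> j) = 1 + (\<Sum>j\<in>UNIV. Poly_Mapping.lookup \<beta> j)"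
    unfolding \<alpha> by (simp add: lookup_add lookup_single when_def sum.distrib)
  then show ?case
    using Suc.hyps \<alpha> add by simp
qed

text \<open>
  Two functionals that agree on the products of powers of the \<open>t i\<close> agree everywhere when the variables are
  affine functions of the \<open>t i\<close>. The induction on the monomial keeps such a product as an additional factor,
  because replacing a variable by its affine expression raises the exponents of that factor.
\<close>

lemma moments_determine:
  fixes l m :: "'n::finite rpoly \<Rightarrow> real" and t :: "'n \<Rightarrow> 'n rpoly"
  assumes l: "linear_functional l" and m: "linear_functional m"
    and eq: "\<And>k. l (\<Prod>i\<in>UNIV. t i ^ k i) = m (\<Prod>i\<in>UNIV. t i ^ k i)"
    and var: "\<And>i. var i = pscale (a i) (t i) + pscale (b i) 1"
  shows "l p = m p"
proof -
  have lin: "l (p + q) = l p + l q" "l (pscale c p) = c * l p"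
      "m (p + q) = m p + m q" "m (pscale c p) = c * m p" for p q c
    using l m unfolding linear_functional_iff by auto
  have assoc: "pscale c p * q = pscale c (p * q)" for c and p q :: "'n rpoly"
    by (simp add: pscale_def mult_map_scale_conv_mult mult.assoc)
  have "\<forall>k. l (monomial \<alpha> * (\<Prod>i\<in>UNIV. t i ^ k i)) = m (monomial \<alpha> * (\<Prod>i\<in>UNIV. t i ^ k i))" for \<alpha>
  proof (induction \<alpha> rule: monomial_induct)
    case zero
    show ?case by (simp add: eq)
  next
    case (add \<alpha> i)
    show ?case
    proof
      fix k
      let ?T = "\<Prod>i\<in>UNIV. t i ^ k i"
      have "t i * ?T = (\<Prod>j\<in>UNIV. (if j = i then t j else 1) * t j ^ k j)"
        by (simp add: prod.distrib)
      also have "\<dots> = (\<Prod>j\<in>UNIV. t j ^ (k(i := Suc (k i))) j)"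
        by (intro prod.cong) auto
      finally have T: "t i * ?T = (\<Prod>j\<in>UNIV. t j ^ (k(i := Suc (k i))) j)" .
      have "monomial (Poly_Mapping.single i 1 + \<alpha>) * ?T = var i * (monomial \<alpha> * ?T)"
        by (simp add: var_def mult.assoc[symmetric] mult_single)
      also have "\<dots> = pscale (a i) (monomial \<alpha> * (t i * ?T)) + pscale (b i) (monomial \<alpha> * ?T)"
        unfolding var distrib_right assoc by (simp add: mult_ac)
      finally have "monomial (Poly_Mapping.single i 1 + \<alpha>) * ?T =
        pscale (a i) (monomial \<alpha> * (t i * ?T)) + pscale (b i) (monomial \<alpha> * ?T)" .
      then show "l (monomial (Poly_Mapping.single i 1 + \<alpha>) * ?T) =
          m (monomial (Poly_Mapping.single i 1 + \<alpha>) * ?T)"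
        unfolding T using add.IH by (simp only: lin)
    qed
  qed
  from this[THEN spec, of _ "\<lambda>_. 0"] have "l (monomial \<alpha>) = m (monomial \<alpha>)" for \<alpha>
    by simp
  then show ?thesis
    unfolding linear_functional_sum_terms[OF l, of p] linear_functional_sum_terms[OF m, of p] by simp
qed

lemma represents_imp_positive_semidefinite:
  assumes "represents M l"
  shows "positive_semidefinite l"
  unfolding positive_semidefinite_def
proof
  fix h
  have "l (h ^ 2) = (LINT x|M. peval (h ^ 2) x)"
    using assms by (simp add: represents_def)
  also have "\<dots> \<ge> 0"
    by (simp add: peval_power)
  finally show "0 \<le> l (h ^ 2)" .
qed

lemma compact_sym_box: "compact (sym_box r :: (real ^ 'n::finite) set)"
proof -
  have "sym_box r = cbox (- r) r"
    by (auto simp: sym_box_def mem_box_cart)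
  then show ?thesis using compact_cbox by metis
qed

text \<open>
  The affine change of variables \<open>t i = (1 + X\<^sub>i / r\<^sub>i) / 2\<close> takes the box to the unit cube. Both \<open>t i\<close> and
  \<open>1 - t i\<close> are half of \<open>1 - p\<close> with \<open>p = \<mp> X\<^sub>i / r\<^sub>i\<close> of norm 1, so they are limits of squares, and so are all
  their products. This is the positivity that the moment problem on the cube asks for, and the measure found there
  is transported back to the box.
\<close>

lemma positive_semidefinite_imp_represented:
  fixes r :: "real ^ 'n::finite" and l :: "'n rpoly \<Rightarrow> real"
  assumes r: "\<And>i. 0 < r $ i" and l: "linear_functional l" and psd: "positive_semidefinite l"
    and C: "\<And>\<alpha>. \<bar>l (monomial \<alpha>)\<bar> \<le> C * monomial_value r \<alpha>"
  shows "\<exists>M :: (real ^ 'n) measure. borel_measure_on (sym_box r) M \<and> represents M l"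
proof -
  have lin: "l (p + q) = l p + l q" "l (pscale c p) = c * l p" for p q c
    using l unfolding linear_functional_iff by auto
  define z :: "'n \<Rightarrow> 'n rpoly" where "z i = Poly_Mapping.single (Poly_Mapping.single i 1) (1 / r $ i)" for i
  define h :: "'n rpoly" where "h = Poly_Mapping.single 0 (1/2)"
  define t where "t i = h * (1 + z i)" for i
  have h2: "h + h = 1"
    by (simp add: h_def single_add[symmetric])
  have one_minus_t: "1 - t i = h * (1 - z i)" for i
    unfolding t_def using h2 by (simp add: algebra_simps)
  have z_norm: "wnorm r (z i) = 1" for i
    using r[of i] by (simp add: z_def monomial_value_unit[simplified])
  \<comment> \<open>One half is a limit of squares because it equals \<open>1 - 1/2\<close>.\<close>
  have sq_h: "limit_of_squares r h"
  proof -
    have "limit_of_squares r (1 - h)"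
      by (intro limit_of_squares_one_minus r) (simp add: h_def monomial_value_def)
    moreover have "1 - h = h" using h2 by (simp add: algebra_simps)
    ultimately show ?thesis by simp
  qed
  have sq_t: "limit_of_squares r (t i)" "limit_of_squares r (1 - t i)" for i
  proof -
    have "limit_of_squares r (1 - (- z i))" "limit_of_squares r (1 - z i)"
      by (intro limit_of_squares_one_minus r; simp add: z_norm)+
    then show "limit_of_squares r (t i)" "limit_of_squares r (1 - t i)"
      by (simp_all add: one_minus_t) (simp_all add: t_def limit_of_squares_mult r sq_h)
  qed
  have pos: "0 \<le> l (\<Prod>i\<in>UNIV. t i ^ a i * (1 - t i) ^ b i)" for a b
    by (rule nonneg_on_limit_of_squares[OF l psd linear_functional_le_wnorm[OF l C]])
      (intro limit_of_squares_prod limit_of_squares_mult limit_of_squares_power sq_t r)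
  obtain M :: "(real ^ 'n) measure" where M: "finite_measure M" "sets M = sets (restrict_space borel unit_cube)"
    and moments: "\<And>k. l (\<Prod>i\<in>UNIV. t i ^ k i) = (LINT x|M. (\<Prod>i\<in>UNIV. x $ i ^ k i))"
    using hausdorff_moment_cube[of l t, OF lin(1) pos] by blast
  have space_M: "space M = unit_cube"
    using sets_eq_imp_space_eq[OF M(2)] by (simp add: space_restrict_space)
  define A :: "real ^ 'n \<Rightarrow> real ^ 'n" where "A x = (\<chi> i. r $ i * (2 * x $ i - 1))" for x
  have A_box: "A x \<in> sym_box r" if "x \<in> unit_cube" for x
  proof -
    have "- r $ i \<le> r $ i * (2 * x $ i - 1)" "r $ i * (2 * x $ i - 1) \<le> r $ i" for i
    proof -
      have "r $ i * (-1) \<le> r $ i * (2 * x $ i - 1)" "r $ i * (2 * x $ i - 1) \<le> r $ i * 1"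
        using that r[of i] by (intro mult_left_mono; simp add: unit_cube_def less_imp_le)+
      then show "- r $ i \<le> r $ i * (2 * x $ i - 1)" "r $ i * (2 * x $ i - 1) \<le> r $ i" by simp_all
    qed
    then show ?thesis by (simp add: A_def sym_box_def)
  qed
  have "continuous_on UNIV A"
    unfolding A_def by (intro continuous_on_vec_lambda continuous_intros)
  then have "A \<in> borel \<rightarrow>\<^sub>M borel"
    by (rule borel_measurable_continuous_onI)
  then have "A \<in> restrict_space borel unit_cube \<rightarrow>\<^sub>M restrict_space borel (sym_box r)"
    using A_box by (intro measurable_restrict_space2 measurable_restrict_space1)
      (auto simp: space_restrict_space)
  then have A_meas: "A \<in> M \<rightarrow>\<^sub>M restrict_space borel (sym_box r)"
    unfolding measurable_cong_sets[OF M(2) refl] .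
  define \<mu> where "\<mu> = distr M (restrict_space borel (sym_box r)) A"
  have \<mu>_fin: "finite_measure \<mu>"
    unfolding \<mu>_def by (rule finite_measure.finite_measure_distr[OF M(1) A_meas])
  have peval_meas: "peval p \<in> borel_measurable (restrict_space borel (sym_box r))" for p :: "'n rpoly"
    by (intro measurable_restrict_space1 borel_measurable_continuous_onI continuous_on_peval)
  have integrable: "integrable \<mu> (peval p)" for p
  proof -
    have "bounded (peval p ` sym_box r)"
      by (intro compact_imp_bounded compact_continuous_image continuous_on_peval compact_sym_box)
    then obtain B where B: "\<And>x. x \<in> sym_box r \<Longrightarrow> norm (peval p x) \<le> B"
      unfolding bounded_iff by blast
    show ?thesis
      by (rule finite_measure.integrable_const_bound[OF \<mu>_fin, of _ B])
        (use B peval_meas in \<open>auto simp: \<mu>_def space_restrict_space intro!: AE_I2\<close>)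
  qed
  define m where "m p = (LINT x|\<mu>. peval p x)" for p
  have pscale: "peval (pscale c p) x = c * peval p x" for c p and x :: "real ^ 'n"
    by (simp add: pscale_def mult_map_scale_conv_mult peval_mult monomial_value_def)
  have m: "linear_functional m"
  proof -
    have "peval (p + q) = (\<lambda>x. peval p x + peval q x)" "peval (pscale c p) = (\<lambda>x. c * peval p x)"
      for p q :: "'n rpoly" and c
      by (auto simp: peval_add pscale)
    then show ?thesis
      unfolding linear_functional_iff m_def using integrable by simp
  qed
  have t_A: "peval (t i) (A x) = x $ i" for i x
  proof -
    have "peval (t i) (A x) = 1/2 * (1 + 1 / r $ i * A x $ i)"
      unfolding t_def h_def z_def
      by (simp only: peval_mult peval_add peval_single peval_1 monomial_value_unit) (simp add: monomial_value_def)
    also have "\<dots> = x $ i"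
      using r[of i] by (simp add: A_def)
    finally show ?thesis .
  qed
  have "l p = m p" for p
  proof (rule moments_determine[OF l m])
    fix k
    have "m (\<Prod>i\<in>UNIV. t i ^ k i) = (LINT x|M. peval (\<Prod>i\<in>UNIV. t i ^ k i) (A x))"
      unfolding m_def \<mu>_def by (rule integral_distr[OF A_meas peval_meas])
    then show "l (\<Prod>i\<in>UNIV. t i ^ k i) = m (\<Prod>i\<in>UNIV. t i ^ k i)"
      by (simp add: moments peval_prod peval_power t_A)
  next
    fix i
    have "pscale (2 * r $ i) (t i) = pscale (r $ i) (1 + z i)"
      by (simp add: t_def h_def pscale_def mult_map_scale_conv_mult mult.assoc[symmetric] mult_single)
    also have "\<dots> = pscale (r $ i) 1 + var i"
      using r[of i] by (intro poly_mapping_eqI)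
        (auto simp: lookup_pscale lookup_add z_def var_def lookup_single when_def algebra_simps)
    also have "pscale (r $ i) 1 = - pscale (- r $ i) 1"
      by (intro poly_mapping_eqI) (simp add: lookup_pscale)
    finally show "var i = pscale (2 * r $ i) (t i) + pscale (- r $ i) 1"
      by simp
  qed
  then have "represents \<mu> l"
    unfolding represents_def using integrable by (simp add: m_def)
  moreover have "borel_measure_on (sym_box r) \<mu>"
    by (simp add: borel_measure_on_def \<mu>_def)
  ultimately show ?thesis by blast
qed

theorem theorem3p15:
  fixes r :: "real ^ 'n::finite" and l :: "'n rpoly \<Rightarrow> real"
  assumes "\<And>i. 0 < r $ i"
    and "linear_functional l"
    and "(\<lambda>\<alpha>. \<bar>l (monomial \<alpha>)\<bar> * (\<Prod>i\<in>UNIV. r $ i powi (- int (Poly_Mapping.lookup \<alpha> i)))) summable_on UNIV"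
  shows "positive_semidefinite l \<longleftrightarrow>
    (\<exists>M :: (real ^ 'n) measure. borel_measure_on (sym_box r) M \<and> represents M l)"
proof
  let ?f = "\<lambda>\<alpha>. \<bar>l (monomial \<alpha>)\<bar> * (\<Prod>i\<in>UNIV. r $ i powi (- int (Poly_Mapping.lookup \<alpha> i)))"
  have weight: "(\<Prod>i\<in>UNIV. r $ i powi (- int (Poly_Mapping.lookup \<alpha> i))) = inverse (monomial_value r \<alpha>)" for \<alpha>
    by (simp add: monomial_value_def power_int_minus prod_inversef[unfolded comp_def])
  \<comment> \<open>A single term of the series of nonnegative terms is at most the sum, which serves as the constant.\<close>
  have bound: "\<bar>l (monomial \<alpha>)\<bar> \<le> infsum ?f UNIV * monomial_value r \<alpha>" for \<alpha>
  proof -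
    have pos: "monomial_value r \<alpha> > 0" for \<alpha>
      by (rule monomial_value_pos[OF assms(1)])
    have "sum ?f {\<alpha>} \<le> infsum ?f UNIV"
      using less_imp_le[OF pos] by (intro finite_sum_le_infsum assms(3)) (auto simp: weight)
    then show ?thesis
      using pos[of \<alpha>] by (simp add: weight field_simps)
  qed
  assume "positive_semidefinite l"
  with assms(1,2) show "\<exists>M :: (real ^ 'n) measure. borel_measure_on (sym_box r) M \<and> represents M l"
    using bound by (rule positive_semidefinite_imp_represented)
next
  assume "\<exists>M :: (real ^ 'n) measure. borel_measure_on (sym_box r) M \<and> represents M l"
  then show "positive_semidefinite l"
    using represents_imp_positive_semidefinite by blast
qed

end
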